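(* Let $n$ be a positive integer and $\mu\in W^{n-1,\infty}(\mathbb{D})$ such that $\|\mu\|_{W^{n-1,\infty}(\mathbb{D})}\le c<1$ for some positive real number $c$. Every solution $w:\mathbb{D}\to\mathbb{C}$ of $$\left(\frac{\partial}{\partial z^*}-\mu\frac{\partial}{\partial z}\right)^n w=0$$ has the form $$w=\sum_{k=0}^{n-1}(z^* )^k w_k,$$ where $\frac{\partial w_k}{\partial z^*}=\mu\frac{\partial w_k}{\partial z}$ for every $0\le k\le n-1$.
   Context: $\mathbb{D}$ is the unit disk in $\mathbb{C}$, $z=x+iy$; $z^*=x-iy$ denotes complex conjugation; $\frac{\partial}{\partial z}=\frac12(\partial_x-i\partial_y)$, $\frac{\partial}{\partial z^*}=\frac12(\partial_x+i\partial_y)$. $W^{k,\infty}(\mathbb{D})$ is the Sobolev space of complex-valued functions that along with their derivatives up to order $k$ are in $L^\infty(\mathbb{D})$. The $n$-th power of the operator denotes $n$-fold iteration. *)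

theory Defs
  imports "HOL-Analysis.Analysis" "HOL-Probability.Essential_Supremum"
begin

text \<open>
  The plane is the type \<^typ>\<open>complex\<close>, with coordinate directions \<open>1\<close> and \<open>\<i>\<close>. A function on a
  domain \<open>\<Omega>\<close> is a total function on \<^typ>\<open>complex\<close> whose values outside \<open>\<Omega>\<close> are never used.
\<close>

definition dir_deriv :: "complex \<Rightarrow> (complex \<Rightarrow> complex) \<Rightarrow> complex \<Rightarrow> complex" where
  "dir_deriv v \<phi> z = frechet_derivative \<phi> (at z) v"

text \<open>
  Being infinitely differentiable in the real sense: all iterated partial derivatives are (totally)
  differentiable everywhere, hence in particular continuous.
\<close>

definition smooth :: "(complex \<Rightarrow> complex) \<Rightarrow> bool" where
  "smooth \<phi> \<longleftrightarrow> (\<forall>vs z. set vs \<subseteq> {1, \<i>} \<longrightarrow> foldr dir_deriv vs \<phi> differentiable (at z))"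

definition test_function :: "complex set \<Rightarrow> (complex \<Rightarrow> complex) \<Rightarrow> bool" where
  "test_function \<Omega> \<phi> \<longleftrightarrow>
     smooth \<phi> \<and> compact (closure {z. \<phi> z \<noteq> 0}) \<and> closure {z. \<phi> z \<noteq> 0} \<subseteq> \<Omega>"

text \<open>Here \<open>1 \<le> p \<le> \<infinity>\<close>; functions are not identified when they agree almost everywhere.\<close>

definition Lp_on :: "ennreal \<Rightarrow> complex set \<Rightarrow> (complex \<Rightarrow> complex) set" where
  "Lp_on p \<Omega> = {f. f \<in> borel_measurable (lebesgue_on \<Omega>) \<and>
     (if p = \<infinity> then esssup (lebesgue_on \<Omega>) (\<lambda>z. ennreal (norm (f z))) < \<infinity>
      else integrable (lebesgue_on \<Omega>) (\<lambda>z. norm (f z) powr enn2real p))}"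

definition Lp_loc :: "ennreal \<Rightarrow> complex set \<Rightarrow> (complex \<Rightarrow> complex) set" where
  "Lp_loc p \<Omega> = {f. \<forall>K. compact K \<longrightarrow> K \<subseteq> \<Omega> \<longrightarrow> f \<in> Lp_on p K}"

text \<open>\<open>g\<close> is the weak (distributional) derivative \<open>\<partial>\<^sub>x\<^sup>a \<partial>\<^sub>y\<^sup>b f\<close> on \<open>\<Omega>\<close>.\<close>

definition has_weak_pderiv ::
  "complex set \<Rightarrow> nat \<Rightarrow> nat \<Rightarrow> (complex \<Rightarrow> complex) \<Rightarrow> (complex \<Rightarrow> complex) \<Rightarrow> bool" where
  "has_weak_pderiv \<Omega> a b f g \<longleftrightarrow> f \<in> Lp_loc 1 \<Omega> \<and> g \<in> Lp_loc 1 \<Omega> \<and>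
     (\<forall>\<phi>. test_function \<Omega> \<phi> \<longrightarrow>
        (LINT z|lebesgue_on \<Omega>. f z * ((dir_deriv 1 ^^ a) ((dir_deriv \<i> ^^ b) \<phi>)) z) =
        (-1) ^ (a + b) * (LINT z|lebesgue_on \<Omega>. g z * \<phi> z))"

text \<open>Meaningful only if the weak derivative exists; it is then unique up to null sets.\<close>

definition weak_pderiv ::
  "complex set \<Rightarrow> nat \<Rightarrow> nat \<Rightarrow> (complex \<Rightarrow> complex) \<Rightarrow> complex \<Rightarrow> complex" where
  "weak_pderiv \<Omega> a b f = (SOME g. has_weak_pderiv \<Omega> a b f g)"

definition sobolev :: "nat \<Rightarrow> ennreal \<Rightarrow> complex set \<Rightarrow> (complex \<Rightarrow> complex) set" where
  "sobolev k p \<Omega> = {f \<in> Lp_on p \<Omega>.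
     \<forall>a b. a + b \<le> k \<longrightarrow> (\<exists>g \<in> Lp_on p \<Omega>. has_weak_pderiv \<Omega> a b f g)}"

definition sobolev_loc :: "nat \<Rightarrow> ennreal \<Rightarrow> complex set \<Rightarrow> (complex \<Rightarrow> complex) set" where
  "sobolev_loc k p \<Omega> = {f \<in> Lp_loc p \<Omega>.
     \<forall>a b. a + b \<le> k \<longrightarrow> (\<exists>g \<in> Lp_loc p \<Omega>. has_weak_pderiv \<Omega> a b f g)}"

text \<open>
  The norm of \<open>W\<^sup>k\<^sup>,\<^sup>\<infinity>(\<Omega>)\<close>, with the convention of taking the maximum (not the sum) over all
  derivatives of order at most \<open>k\<close>. As the maximum is the smaller of the two, an upper bound on it
  is the weaker assumption.
\<close>

definition sobolev_inf_norm :: "nat \<Rightarrow> complex set \<Rightarrow> (complex \<Rightarrow> complex) \<Rightarrow> ennreal" where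
  "sobolev_inf_norm k \<Omega> f =
     (SUP (a, b) \<in> {(a, b). a + b \<le> k}.
        esssup (lebesgue_on \<Omega>) (\<lambda>z. ennreal (norm (weak_pderiv \<Omega> a b f z))))"

text \<open>The Wirtinger derivatives \<open>\<partial>/\<partial>z\<close> and \<open>\<partial>/\<partial>z\<^sup>*\<close> in the weak sense.\<close>

definition has_weak_dz ::
  "complex set \<Rightarrow> (complex \<Rightarrow> complex) \<Rightarrow> (complex \<Rightarrow> complex) \<Rightarrow> bool" where
  "has_weak_dz \<Omega> f g \<longleftrightarrow> (\<exists>gx gy. has_weak_pderiv \<Omega> 1 0 f gx \<and> has_weak_pderiv \<Omega> 0 1 f gy \<and>
     (AE z in lebesgue_on \<Omega>. g z = (gx z - \<i> * gy z) / 2))"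

definition has_weak_dzbar ::
  "complex set \<Rightarrow> (complex \<Rightarrow> complex) \<Rightarrow> (complex \<Rightarrow> complex) \<Rightarrow> bool" where
  "has_weak_dzbar \<Omega> f g \<longleftrightarrow> (\<exists>gx gy. has_weak_pderiv \<Omega> 1 0 f gx \<and> has_weak_pderiv \<Omega> 0 1 f gy \<and>
     (AE z in lebesgue_on \<Omega>. g z = (gx z + \<i> * gy z) / 2))"

text \<open>
  The operator \<open>\<partial>/\<partial>z\<^sup>* - \<mu> \<partial>/\<partial>z\<close> with domain \<open>W\<^sup>1\<^sup>,\<^sup>p\<close> (locally on \<open>\<Omega>\<close>), given by its graph: since it is
  partial, and since its values are determined only up to null sets, it is a relation between \<open>f\<close>
  and its image \<open>h\<close>. Its \<open>n\<close>-fold iterate is the relational power.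
\<close>

definition beltrami_op ::
  "ennreal \<Rightarrow> complex set \<Rightarrow> (complex \<Rightarrow> complex) \<Rightarrow> (complex \<Rightarrow> complex) \<Rightarrow> (complex \<Rightarrow> complex) \<Rightarrow> bool"
where
  "beltrami_op p \<Omega> \<mu> f h \<longleftrightarrow> f \<in> sobolev_loc 1 p \<Omega> \<and>
     (\<exists>fz fzbar. has_weak_dz \<Omega> f fz \<and> has_weak_dzbar \<Omega> f fzbar \<and>
        (AE z in lebesgue_on \<Omega>. h z = fzbar z - \<mu> z * fz z))"

end

theory Submission
  imports Defs
begin

text \<open>
  Write \<open>D\<close> for \<open>\<partial>/\<partial>z\<^sup>* - \<mu> \<partial>/\<partial>z\<close>. Since \<open>D z\<^sup>* = 1\<close>, the product rule reads
  \<open>D (z\<^sup>* f) = f + z\<^sup>* D f\<close>, so a null solution \<open>v\<close> of \<open>D\<close> yields \<open>D ((z\<^sup>*)\<^sup>k\<^sup>+\<^sup>1 v / (k + 1)) = (z\<^sup>*)\<^sup>k v\<close>.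
  If inductively \<open>D w = \<Sum>\<^sub>k (z\<^sup>*)\<^sup>k v\<^sub>k\<close> with \<open>D v\<^sub>k = 0\<close>, then subtracting
  \<open>\<Sum>\<^sub>k (z\<^sup>*)\<^sup>k\<^sup>+\<^sup>1 v\<^sub>k / (k + 1)\<close> from \<open>w\<close> leaves a null solution of \<open>D\<close>. The product rule in the weak
  sense follows by using \<open>z\<^sup>* \<phi>\<close> as a test function.
\<close>

section \<open>Directional derivatives and smooth functions\<close>

lemma dir_deriv_eq:
  assumes "(f has_derivative f') (at z)"
  shows "dir_deriv v f z = f' v"
  unfolding dir_deriv_def using frechet_derivative_at[OF assms] by simp

lemma has_derivative_dir_deriv:
  assumes "f differentiable (at z)"
  shows "(f has_derivative (\<lambda>v. dir_deriv v f z)) (at z)"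
  using assms unfolding dir_deriv_def frechet_derivative_works .

lemma dir_deriv_lincomb:
  assumes "f differentiable (at z)" "g differentiable (at z)"
  shows "dir_deriv v (\<lambda>z. a * f z + b * g z) z = a * dir_deriv v f z + b * dir_deriv v g z"
  by (rule dir_deriv_eq)
    (intro derivative_intros has_derivative_dir_deriv assms)

lemma dir_deriv_cnj_mult:
  assumes "f differentiable (at z)"
  shows "dir_deriv v (\<lambda>z. cnj z * f z) z = cnj v * f z + cnj z * dir_deriv v f z"
proof -
  have "((\<lambda>z. cnj z * f z) has_derivative (\<lambda>v. cnj z * dir_deriv v f z + cnj v * f z)) (at z)"
    by (intro has_derivative_mult has_derivative_dir_deriv assms has_derivative_cnj
        has_derivative_ident)
  from dir_deriv_eq[OF this] show ?thesis by simp
qed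

lemma smooth_imp_differentiable: "smooth \<phi> \<Longrightarrow> \<phi> differentiable (at z)"
  unfolding smooth_def by (drule spec[of _ "[]"]) simp

lemma smooth_dir_deriv:
  assumes "smooth \<phi>" "v \<in> {1, \<i>}"
  shows "smooth (dir_deriv v \<phi>)"
  unfolding smooth_def
proof (intro allI impI)
  fix vs z assume "set vs \<subseteq> {1, \<i>}"
  \<comment> \<open>\<open>foldr\<close> applies the last list entry first, so the extra direction
    \<open>v\<close> goes to the end of the list.\<close>
  with assms show "foldr dir_deriv vs (dir_deriv v \<phi>) differentiable at z"
    unfolding smooth_def by (elim allE[of _ "vs @ [v]"] allE[of _ z]) simp
qed

text \<open>Every iterated partial derivative stays inside a set closed under both partials.
  Smoothness thus follows from one differentiation step, without formulas for higher
  derivatives.\<close>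

lemma smooth_coinduct:
  assumes "\<phi> \<in> S"
    and diff: "\<And>f z. f \<in> S \<Longrightarrow> f differentiable (at z)"
    and closed: "\<And>f v. f \<in> S \<Longrightarrow> v \<in> {1, \<i>} \<Longrightarrow> dir_deriv v f \<in> S"
  shows "smooth \<phi>"
proof -
  have "set vs \<subseteq> {1, \<i>} \<Longrightarrow> foldr dir_deriv vs \<phi> \<in> S" for vs
    by (induction vs) (simp_all add: assms(1) closed)
  then show ?thesis unfolding smooth_def using diff by blast
qed

lemma smooth_lincomb:
  assumes "smooth \<phi>" "smooth \<psi>"
  shows "smooth (\<lambda>z. a * \<phi> z + b * \<psi> z)"
proof (rule smooth_coinduct[of _ "{\<lambda>z. a * \<phi> z + b * \<psi> z |\<phi> \<psi>. smooth \<phi> \<and> smooth \<psi>}"])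
  show "(\<lambda>z. a * \<phi> z + b * \<psi> z) \<in> {\<lambda>z. a * \<phi> z + b * \<psi> z |\<phi> \<psi>. smooth \<phi> \<and> smooth \<psi>}"
    using assms by blast
next
  fix f z assume "f \<in> {\<lambda>z. a * \<phi> z + b * \<psi> z |\<phi> \<psi>. smooth \<phi> \<and> smooth \<psi>}"
  then obtain \<phi> \<psi> where f: "f = (\<lambda>z. a * \<phi> z + b * \<psi> z)" "smooth \<phi>" "smooth \<psi>" by blast
  show "f differentiable (at z)"
    unfolding f(1) using f(2,3)
    by (intro differentiable_add differentiable_mult differentiable_const smooth_imp_differentiable)
next
  fix f v assume "f \<in> {\<lambda>z. a * \<phi> z + b * \<psi> z |\<phi> \<psi>. smooth \<phi> \<and> smooth \<psi>}"
    and v: "v \<in> {1, \<i>}"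
  then obtain \<phi> \<psi> where f: "f = (\<lambda>z. a * \<phi> z + b * \<psi> z)" "smooth \<phi>" "smooth \<psi>" by blast
  then have "dir_deriv v f = (\<lambda>z. a * dir_deriv v \<phi> z + b * dir_deriv v \<psi> z)"
    by (auto intro!: dir_deriv_lincomb smooth_imp_differentiable)
  then show "dir_deriv v f \<in> {\<lambda>z. a * \<phi> z + b * \<psi> z |\<phi> \<psi>. smooth \<phi> \<and> smooth \<psi>}"
    using f v smooth_dir_deriv by blast
qed

text \<open>Products \<open>cnj z * \<phi> z\<close> alone are not closed under differentiation,
  since the product rule adds \<open>cnj v * \<phi> z\<close>. The set \<open>?S\<close> allows an
  arbitrary smooth summand, which absorbs this term.\<close>

lemma smooth_cnj_mult:
  assumes "smooth \<phi>"
  shows "smooth (\<lambda>z. cnj z * \<phi> z)"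
proof -
  let ?S = "{\<lambda>z. cnj z * \<phi> z + \<psi> z |\<phi> \<psi>. smooth \<phi> \<and> smooth \<psi>}"
  have diff: "(\<lambda>z. cnj z * \<phi> z) differentiable (at z)" if "smooth \<phi>" for \<phi> z
    by (intro differentiable_mult smooth_imp_differentiable that
        differentiableI[OF has_derivative_cnj[OF has_derivative_ident]])
  show ?thesis
  proof (rule smooth_coinduct[of _ ?S])
    have "smooth (\<lambda>z. 0)" using smooth_lincomb[OF assms assms, of 0 0] by simp
    then show "(\<lambda>z. cnj z * \<phi> z) \<in> ?S" using assms by force
  next
    fix f z assume "f \<in> ?S"
    then obtain \<phi> \<psi> where f: "f = (\<lambda>z. cnj z * \<phi> z + \<psi> z)" "smooth \<phi>" "smooth \<psi>" by blast
    show "f differentiable (at z)"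
      unfolding f(1) by (intro differentiable_add diff f(2) smooth_imp_differentiable f(3))
  next
    fix f v assume "f \<in> ?S" and v: "v \<in> {1, \<i>}"
    then obtain \<phi> \<psi> where f: "f = (\<lambda>z. cnj z * \<phi> z + \<psi> z)" "smooth \<phi>" "smooth \<psi>" by blast
    have "dir_deriv v f z = cnj z * dir_deriv v \<phi> z + (cnj v * \<phi> z + 1 * dir_deriv v \<psi> z)" for z
      using dir_deriv_lincomb[OF diff[OF f(2)] smooth_imp_differentiable[OF f(3)], of v 1 1 z]
        dir_deriv_cnj_mult[OF smooth_imp_differentiable[OF f(2)], of v z] f(1) by simp
    then have "dir_deriv v f = (\<lambda>z. cnj z * dir_deriv v \<phi> z + (cnj v * \<phi> z + 1 * dir_deriv v \<psi> z))"
      by blast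
    moreover have "smooth (dir_deriv v \<phi>)" "smooth (\<lambda>z. cnj v * \<phi> z + 1 * dir_deriv v \<psi> z)"
      by (intro smooth_lincomb smooth_dir_deriv f v)+
    ultimately show "dir_deriv v f \<in> ?S" by (intro CollectI exI conjI)
  qed
qed

section \<open>Test functions\<close>

lemma test_function_support_mono:
  assumes "test_function \<Omega> \<phi>" "smooth \<psi>" "{z. \<psi> z \<noteq> 0} \<subseteq> closure {z. \<phi> z \<noteq> 0}"
  shows "test_function \<Omega> \<psi>"
proof -
  have "closure {z. \<psi> z \<noteq> 0} \<subseteq> closure {z. \<phi> z \<noteq> 0}"
    using assms(3) by (simp add: closure_minimal)
  moreover from this have "compact (closure {z. \<psi> z \<noteq> 0})"
    using assms(1) compact_Int_closed[OF _ closed_closure, of "closure {z. \<phi> z \<noteq> 0}" "{z. \<psi> z \<noteq> 0}"]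
    by (simp add: test_function_def inf.absorb2)
  ultimately show ?thesis
    using assms(1,2) unfolding test_function_def by (meson subset_trans)
qed

lemma test_function_cnj_mult:
  assumes "test_function \<Omega> \<phi>"
  shows "test_function \<Omega> (\<lambda>z. cnj z * \<phi> z)"
  by (rule test_function_support_mono[OF assms])
    (use assms in \<open>auto simp: test_function_def intro!: smooth_cnj_mult subsetD[OF closure_subset]\<close>)

lemma test_function_dir_deriv:
  assumes "test_function \<Omega> \<phi>" "v \<in> {1, \<i>}"
  shows "test_function \<Omega> (dir_deriv v \<phi>)"
proof (rule test_function_support_mono[OF assms(1)])
  show "smooth (dir_deriv v \<phi>)"
    using assms smooth_dir_deriv by (simp add: test_function_def)
  show "{z. dir_deriv v \<phi> z \<noteq> 0} \<subseteq> closure {z. \<phi> z \<noteq> 0}"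
  proof (rule ccontr)
    assume "\<not> ?thesis"
    then obtain z where z: "dir_deriv v \<phi> z \<noteq> 0" "z \<in> - closure {z. \<phi> z \<noteq> 0}" by blast
    \<comment> \<open>On the open complement of its closed support, \<phi> coincides with the zero
      function, so its derivative vanishes there.\<close>
    have "((\<lambda>_. 0) has_derivative (\<lambda>_. 0)) (at z)" by simp
    then have "(\<phi> has_derivative (\<lambda>_. 0)) (at z)"
      by (rule has_derivative_transform_within_open[OF _ _ z(2)]) (use closure_subset[of "{z. \<phi> z \<noteq> 0}"] in auto)
    with z(1) dir_deriv_eq show False by blast
  qed
qed

lemma test_function_dir_deriv_funpow:
  assumes "test_function \<Omega> \<phi>" "v \<in> {1, \<i>}"
  shows "test_function \<Omega> ((dir_deriv v ^^ a) \<phi>)"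
  by (induction a) (simp_all add: assms(1) test_function_dir_deriv[OF _ assms(2)])

section \<open>Global and local Lebesgue spaces\<close>

lemma Lp_on_add:
  assumes f: "f \<in> Lp_on p K" and g: "g \<in> Lp_on p K"
  shows "(\<lambda>z. f z + g z) \<in> Lp_on p K"
proof -
  let ?M = "lebesgue_on K" and ?q = "enn2real p"
  have [measurable]: "f \<in> borel_measurable ?M" "g \<in> borel_measurable ?M"
    using f g by (auto simp: Lp_on_def)
  show ?thesis
  proof (cases "p = \<infinity>")
    case True
    let ?s = "\<lambda>f. esssup ?M (\<lambda>z. ennreal (norm (f z)))"
    have fin: "?s f < \<infinity>" "?s g < \<infinity>" using f g True by (auto simp: Lp_on_def)
    have "AE z in ?M. ennreal (norm (f z)) \<le> ?s f" "AE z in ?M. ennreal (norm (g z)) \<le> ?s g"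
      by (intro esssup_AE; measurable)+
    then have "AE z in ?M. ennreal (norm (f z + g z)) \<le> ?s f + ?s g"
    proof eventually_elim
      case (elim z)
      have "ennreal (norm (f z + g z)) \<le> ennreal (norm (f z)) + ennreal (norm (g z))"
        by (simp add: norm_triangle_ineq ennreal_leI flip: ennreal_plus)
      with elim show ?case by (meson add_mono order_trans)
    qed
    then have "?s (\<lambda>z. f z + g z) \<le> ?s f + ?s g" by (intro esssup_I) measurable
    also have "\<dots> < \<infinity>" using fin by simp
    finally show ?thesis using True by (simp add: Lp_on_def)
  next
    case False
    \<comment> \<open>This dominating function replaces Minkowski's inequality: |f + g| is at most
      twice the larger of |f| and |g|, and the power of a maximum is at most the sum of the
      powers.\<close>
    have "integrable ?M (\<lambda>z. 2 powr ?q * (norm (f z) powr ?q + norm (g z) powr ?q))"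
      using f g False by (simp add: Lp_on_def)
    then have "integrable ?M (\<lambda>z. norm (f z + g z) powr ?q)"
    proof (rule Bochner_Integration.integrable_bound)
      show "AE z in ?M. norm (norm (f z + g z) powr ?q)
          \<le> norm (2 powr ?q * (norm (f z) powr ?q + norm (g z) powr ?q))"
      proof (rule AE_I2)
        fix z
        let ?m = "max (norm (f z)) (norm (g z))"
        have "norm (f z + g z) \<le> 2 * ?m" using norm_triangle_ineq[of "f z" "g z"] by linarith
        then have "norm (f z + g z) powr ?q \<le> (2 * ?m) powr ?q" by (simp add: powr_mono2)
        also have "\<dots> = 2 powr ?q * ?m powr ?q" by (simp add: powr_mult)
        also have "\<dots> \<le> 2 powr ?q * (norm (f z) powr ?q + norm (g z) powr ?q)"
          by (auto simp: max_def)
        finally show "norm (norm (f z + g z) powr ?q)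
          \<le> norm (2 powr ?q * (norm (f z) powr ?q + norm (g z) powr ?q))" by simp
      qed
    qed measurable
    then show ?thesis using False by (simp add: Lp_on_def)
  qed
qed

lemma Lp_on_bounded_mult:
  assumes f: "f \<in> Lp_on p K" and u [measurable]: "u \<in> borel_measurable (lebesgue_on K)"
    and bound: "\<And>z. z \<in> K \<Longrightarrow> norm (u z) \<le> C"
  shows "(\<lambda>z. u z * f z) \<in> Lp_on p K"
proof -
  \<comment> \<open>For empty \<open>K\<close> the bound \<open>C\<close> may be negative;
    \<open>max C 0\<close> is a nonnegative bound in every case.\<close>
  let ?M = "lebesgue_on K" and ?q = "enn2real p" and ?C = "max C 0"
  have [measurable]: "f \<in> borel_measurable ?M" using f by (simp add: Lp_on_def)
  have le: "norm (u z * f z) \<le> ?C * norm (f z)" if "z \<in> space ?M" for z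
  proof -
    have "norm (u z) \<le> ?C" using bound[of z] that by simp
    then show ?thesis by (simp add: norm_mult mult_right_mono)
  qed
  show ?thesis
  proof (cases "p = \<infinity>")
    case True
    let ?s = "esssup ?M (\<lambda>z. ennreal (norm (f z)))"
    have fin: "?s < \<infinity>" using f True by (simp add: Lp_on_def)
    have "AE z in ?M. ennreal (norm (f z)) \<le> ?s" by (intro esssup_AE) measurable
    then have "AE z in ?M. ennreal (norm (u z * f z)) \<le> ennreal ?C * ?s"
      using AE_space
    proof eventually_elim
      case (elim z)
      have "ennreal (norm (u z * f z)) \<le> ennreal ?C * ennreal (norm (f z))"
        using le[OF elim(2)] by (simp add: ennreal_leI flip: ennreal_mult)
      with elim(1) show ?case by (meson mult_left_mono order_trans zero_le)
    qed
    then have "esssup ?M (\<lambda>z. ennreal (norm (u z * f z))) \<le> ennreal ?C * ?s"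
      by (intro esssup_I) measurable
    also have "\<dots> < \<infinity>" using fin by (simp add: ennreal_mult_less_top)
    finally show ?thesis using True by (simp add: Lp_on_def)
  next
    case False
    have "integrable ?M (\<lambda>z. ?C powr ?q * norm (f z) powr ?q)"
      using f False by (simp add: Lp_on_def)
    then have "integrable ?M (\<lambda>z. norm (u z * f z) powr ?q)"
    proof (rule Bochner_Integration.integrable_bound)
      show "AE z in ?M. norm (norm (u z * f z) powr ?q) \<le> norm (?C powr ?q * norm (f z) powr ?q)"
        by (rule AE_I2) (use le in \<open>simp add: powr_mono2 flip: powr_mult\<close>)
    qed measurable
    then show ?thesis using False by (simp add: Lp_on_def)
  qed
qed

text \<open>A continuous factor is bounded on each compact set, which is all that local
  integrability sees. Both constants and \<open>cnj\<close> are such factors.\<close>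

lemma Lp_loc_continuous_mult:
  assumes "f \<in> Lp_loc p \<Omega>" "continuous_on UNIV u"
  shows "(\<lambda>z. u z * f z) \<in> Lp_loc p \<Omega>"
  unfolding Lp_loc_def
proof (intro CollectI allI impI)
  fix K assume K: "compact K" "K \<subseteq> \<Omega>"
  have cont: "continuous_on K u" using assms(2) continuous_on_subset by blast
  then have "bounded (u ` K)" using K compact_continuous_image compact_imp_bounded by blast
  then obtain C where "\<And>z. z \<in> K \<Longrightarrow> norm (u z) \<le> C" by (auto simp: bounded_iff)
  moreover have "K \<in> sets lebesgue" using fmeasurableD[OF lmeasurable_compact[OF K(1)]] .
  then have "u \<in> borel_measurable (lebesgue_on K)"
    using cont continuous_imp_measurable_on_sets_lebesgue by blast
  ultimately show "(\<lambda>z. u z * f z) \<in> Lp_on p K"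
    using assms(1) K by (intro Lp_on_bounded_mult) (auto simp: Lp_loc_def)
qed

lemma Lp_loc_add:
  assumes "f \<in> Lp_loc p \<Omega>" "g \<in> Lp_loc p \<Omega>"
  shows "(\<lambda>z. f z + g z) \<in> Lp_loc p \<Omega>"
  using assms by (simp add: Lp_loc_def Lp_on_add)

lemma Lp_loc_lincomb:
  assumes "f \<in> Lp_loc p \<Omega>" "g \<in> Lp_loc p \<Omega>"
  shows "(\<lambda>z. a * f z + b * g z) \<in> Lp_loc p \<Omega>"
  by (intro Lp_loc_add Lp_loc_continuous_mult assms continuous_on_const)

lemma Lp_loc_cnj_mult:
  assumes "f \<in> Lp_loc p \<Omega>"
  shows "(\<lambda>z. cnj z * f z) \<in> Lp_loc p \<Omega>"
  by (intro Lp_loc_continuous_mult assms continuous_intros)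

section \<open>Weak partial derivatives\<close>

text \<open>The integrand is integrable over the compact support of \<phi> and vanishes off it. This
  integrability justifies splitting the integrals in the rules for weak derivatives below.\<close>

lemma integrable_mult_test_function:
  assumes "open \<Omega>" "f \<in> Lp_loc 1 \<Omega>" "test_function \<Omega> \<phi>"
  shows "integrable (lebesgue_on \<Omega>) (\<lambda>z. f z * \<phi> z)"
proof -
  define K where "K = closure {z. \<phi> z \<noteq> 0}"
  have K: "compact K" "K \<subseteq> \<Omega>" and smooth: "smooth \<phi>"
    using assms(3) by (auto simp: test_function_def K_def)
  have meas: "K \<in> sets lebesgue" "\<Omega> \<in> sets lebesgue"
    using fmeasurableD[OF lmeasurable_compact[OF K(1)]] assms(1) by auto
  have "continuous_on UNIV \<phi>"
    using smooth smooth_imp_differentiable differentiable_imp_continuous_within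
    by (metis continuous_at_imp_continuous_on)
  then have "(\<lambda>z. \<phi> z * f z) \<in> Lp_on 1 K"
    using Lp_loc_continuous_mult[OF assms(2)] K unfolding Lp_loc_def by blast
  \<comment> \<open>For exponent 1, membership in \<open>Lp_on\<close> says that the function is
    measurable with integrable norm.\<close>
  then have "integrable (lebesgue_on K) (\<lambda>z. f z * \<phi> z)"
    using integrable_norm_iff[of "\<lambda>z. \<phi> z * f z" "lebesgue_on K"]
    by (simp add: Lp_on_def mult.commute)
  then have "integrable lebesgue (\<lambda>z. indicator K z *\<^sub>R (f z * \<phi> z))"
    using meas by (simp add: integrable_restrict_space)
  moreover have "indicator K z *\<^sub>R (f z * \<phi> z) = indicator \<Omega> z *\<^sub>R (f z * \<phi> z)" for z
    using K(2) closure_subset[of "{z. \<phi> z \<noteq> 0}"] unfolding K_def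
    by (cases "\<phi> z = 0") (auto simp: indicator_def)
  ultimately show ?thesis
    using meas by (simp add: integrable_restrict_space)
qed

lemma has_weak_pderiv_lincomb:
  assumes "open \<Omega>" and f: "has_weak_pderiv \<Omega> m n f f'" and g: "has_weak_pderiv \<Omega> m n g g'"
  shows "has_weak_pderiv \<Omega> m n (\<lambda>z. a * f z + b * g z) (\<lambda>z. a * f' z + b * g' z)"
  unfolding has_weak_pderiv_def
proof (intro conjI allI impI)
  have Lp: "f \<in> Lp_loc 1 \<Omega>" "f' \<in> Lp_loc 1 \<Omega>" "g \<in> Lp_loc 1 \<Omega>" "g' \<in> Lp_loc 1 \<Omega>"
    using f g unfolding has_weak_pderiv_def by blast+
  then show "(\<lambda>z. a * f z + b * g z) \<in> Lp_loc 1 \<Omega>" "(\<lambda>z. a * f' z + b * g' z) \<in> Lp_loc 1 \<Omega>"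
    by (intro Lp_loc_lincomb; simp)+
  fix \<phi> assume \<phi>: "test_function \<Omega> \<phi>"
  let ?\<psi> = "(dir_deriv 1 ^^ m) ((dir_deriv \<i> ^^ n) \<phi>)"
  have \<psi>: "test_function \<Omega> ?\<psi>" using \<phi> by (simp add: test_function_dir_deriv_funpow)
  have lin: "(LINT z|lebesgue_on \<Omega>. (a * u z + b * v z) * \<eta> z) =
      a * (LINT z|lebesgue_on \<Omega>. u z * \<eta> z) + b * (LINT z|lebesgue_on \<Omega>. v z * \<eta> z)"
    if "u \<in> Lp_loc 1 \<Omega>" "v \<in> Lp_loc 1 \<Omega>" "test_function \<Omega> \<eta>" for u v \<eta>
    using integrable_mult_test_function[OF assms(1) that(1,3)]
      integrable_mult_test_function[OF assms(1) that(2,3)]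
    by (simp add: distrib_right mult.assoc)
  have "(LINT z|lebesgue_on \<Omega>. f z * ?\<psi> z) = (-1) ^ (m + n) * (LINT z|lebesgue_on \<Omega>. f' z * \<phi> z)"
    "(LINT z|lebesgue_on \<Omega>. g z * ?\<psi> z) = (-1) ^ (m + n) * (LINT z|lebesgue_on \<Omega>. g' z * \<phi> z)"
    using f g \<phi> unfolding has_weak_pderiv_def by blast+
  then show "(LINT z|lebesgue_on \<Omega>. (a * f z + b * g z) * ?\<psi> z) =
      (-1) ^ (m + n) * (LINT z|lebesgue_on \<Omega>. (a * f' z + b * g' z) * \<phi> z)"
    unfolding lin[OF Lp(1,3) \<psi>] lin[OF Lp(2,4) \<phi>] by (simp only: distrib_left mult.left_commute)
qed

text \<open>Treats both coordinate directions at once: the derivative of \<open>cnj\<close> in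
  direction \<open>v\<close> is \<open>cnj v\<close>, that is 1 for x and \<open>- \<i>\<close> for
  y.\<close>

lemma weak_derivative_cnj_mult:
  assumes "open \<Omega>" and Lp: "f \<in> Lp_loc 1 \<Omega>" "g \<in> Lp_loc 1 \<Omega>" and v: "v \<in> {1, \<i>}"
    and weak: "\<And>\<phi>. test_function \<Omega> \<phi> \<Longrightarrow>
      (LINT z|lebesgue_on \<Omega>. f z * dir_deriv v \<phi> z) = - (LINT z|lebesgue_on \<Omega>. g z * \<phi> z)"
    and \<phi>: "test_function \<Omega> \<phi>"
  shows "(LINT z|lebesgue_on \<Omega>. (cnj z * f z) * dir_deriv v \<phi> z) =
    - (LINT z|lebesgue_on \<Omega>. (cnj v * f z + cnj z * g z) * \<phi> z)"
proof -
  let ?\<psi> = "\<lambda>z. cnj z * \<phi> z"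
  have \<psi>: "test_function \<Omega> ?\<psi>" by (rule test_function_cnj_mult[OF \<phi>])
  note int = integrable_mult_test_function[OF assms(1)]
  have "dir_deriv v ?\<psi> z = cnj v * \<phi> z + cnj z * dir_deriv v \<phi> z" for z
    using \<phi> by (intro dir_deriv_cnj_mult smooth_imp_differentiable) (simp add: test_function_def)
  \<comment> \<open>The product rule for \<open>?\<psi>\<close>, solved for
    \<open>cnj z * dir_deriv v \<phi> z\<close>, leaves a term to which the hypothesis on
    \<open>f\<close> applies with test function \<open>?\<psi>\<close>.\<close>
  then have "(LINT z|lebesgue_on \<Omega>. (cnj z * f z) * dir_deriv v \<phi> z) =
      (LINT z|lebesgue_on \<Omega>. f z * dir_deriv v ?\<psi> z - cnj v * (f z * \<phi> z))"
    by (intro Bochner_Integration.integral_cong) (auto simp: algebra_simps)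
  also have "\<dots> = (LINT z|lebesgue_on \<Omega>. f z * dir_deriv v ?\<psi> z)
      - (LINT z|lebesgue_on \<Omega>. cnj v * (f z * \<phi> z))"
    by (intro Bochner_Integration.integral_diff integrable_mult_right int
        Lp \<phi> \<psi> test_function_dir_deriv v)
  also have "\<dots> = - ((LINT z|lebesgue_on \<Omega>. cnj v * (f z * \<phi> z))
      + (LINT z|lebesgue_on \<Omega>. g z * ?\<psi> z))"
    using weak[OF \<psi>] by simp
  also have "(LINT z|lebesgue_on \<Omega>. cnj v * (f z * \<phi> z)) + (LINT z|lebesgue_on \<Omega>. g z * ?\<psi> z)
      = (LINT z|lebesgue_on \<Omega>. cnj v * (f z * \<phi> z) + g z * ?\<psi> z)"
    by (intro Bochner_Integration.integral_add[symmetric] integrable_mult_right int Lp \<phi> \<psi>)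
  also have "\<dots> = (LINT z|lebesgue_on \<Omega>. (cnj v * f z + cnj z * g z) * \<phi> z)"
    by (intro Bochner_Integration.integral_cong) (auto simp: algebra_simps)
  finally show ?thesis .
qed

text \<open>The coefficients 1 are kept so that the derivative matches the form of
  \<open>Lp_loc_lincomb\<close>.\<close>

lemma has_weak_pderiv_x_cnj_mult:
  assumes "open \<Omega>" "has_weak_pderiv \<Omega> 1 0 f g"
  shows "has_weak_pderiv \<Omega> 1 0 (\<lambda>z. cnj z * f z) (\<lambda>z. 1 * f z + 1 * (cnj z * g z))"
proof -
  have Lp: "f \<in> Lp_loc 1 \<Omega>" "g \<in> Lp_loc 1 \<Omega>" using assms(2) unfolding has_weak_pderiv_def by blast+
  have "(LINT z|lebesgue_on \<Omega>. f z * dir_deriv 1 \<phi> z) = - (LINT z|lebesgue_on \<Omega>. g z * \<phi> z)"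
    if "test_function \<Omega> \<phi>" for \<phi>
    using assms(2) that by (simp add: has_weak_pderiv_def)
  from weak_derivative_cnj_mult[OF assms(1) Lp _ this]
  show ?thesis
    unfolding has_weak_pderiv_def by (simp add: Lp Lp_loc_cnj_mult Lp_loc_lincomb[of _ _ _ _ 1 1, simplified])
qed

lemma has_weak_pderiv_y_cnj_mult:
  assumes "open \<Omega>" "has_weak_pderiv \<Omega> 0 1 f g"
  shows "has_weak_pderiv \<Omega> 0 1 (\<lambda>z. cnj z * f z) (\<lambda>z. (- \<i>) * f z + 1 * (cnj z * g z))"
proof -
  have Lp: "f \<in> Lp_loc 1 \<Omega>" "g \<in> Lp_loc 1 \<Omega>" using assms(2) unfolding has_weak_pderiv_def by blast+
  have "(LINT z|lebesgue_on \<Omega>. f z * dir_deriv \<i> \<phi> z) = - (LINT z|lebesgue_on \<Omega>. g z * \<phi> z)"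
    if "test_function \<Omega> \<phi>" for \<phi>
    using assms(2) that by (simp add: has_weak_pderiv_def)
  from weak_derivative_cnj_mult[OF assms(1) Lp _ this]
  show ?thesis
    unfolding has_weak_pderiv_def by (simp add: Lp Lp_loc_cnj_mult Lp_loc_lincomb[of _ _ _ _ "- \<i>" 1, simplified])
qed

section \<open>Local Sobolev spaces\<close>

lemma sobolev_loc_lincomb:
  assumes "open \<Omega>" "f \<in> sobolev_loc k p \<Omega>" "g \<in> sobolev_loc k p \<Omega>"
  shows "(\<lambda>z. a * f z + b * g z) \<in> sobolev_loc k p \<Omega>"
  unfolding sobolev_loc_def
proof (intro CollectI conjI allI impI)
  show "(\<lambda>z. a * f z + b * g z) \<in> Lp_loc p \<Omega>"
    using assms by (intro Lp_loc_lincomb) (auto simp: sobolev_loc_def)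
  fix m n assume "m + n \<le> k"
  then obtain f' g' where "f' \<in> Lp_loc p \<Omega>" "has_weak_pderiv \<Omega> m n f f'"
    "g' \<in> Lp_loc p \<Omega>" "has_weak_pderiv \<Omega> m n g g'"
    using assms by (fastforce simp: sobolev_loc_def)
  then show "\<exists>h\<in>Lp_loc p \<Omega>. has_weak_pderiv \<Omega> m n (\<lambda>z. a * f z + b * g z) h"
    using has_weak_pderiv_lincomb[OF assms(1)] Lp_loc_lincomb by blast
qed

lemma sobolev_loc_cnj_mult:
  assumes "open \<Omega>" "f \<in> sobolev_loc 1 p \<Omega>"
  shows "(\<lambda>z. cnj z * f z) \<in> sobolev_loc 1 p \<Omega>"
  unfolding sobolev_loc_def
proof (intro CollectI conjI allI impI)
  have f: "f \<in> Lp_loc p \<Omega>" using assms by (simp add: sobolev_loc_def)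
  then show cnj_f: "(\<lambda>z. cnj z * f z) \<in> Lp_loc p \<Omega>" by (rule Lp_loc_cnj_mult)
  fix m n :: nat assume mn: "m + n \<le> 1"
  then obtain g where g: "g \<in> Lp_loc p \<Omega>" "has_weak_pderiv \<Omega> m n f g"
    using assms by (fastforce simp: sobolev_loc_def)
  consider "m = 0" "n = 0" | "m = 1" "n = 0" | "m = 0" "n = 1" using mn by linarith
  then show "\<exists>h\<in>Lp_loc p \<Omega>. has_weak_pderiv \<Omega> m n (\<lambda>z. cnj z * f z) h"
  proof cases
    \<comment> \<open>At order zero the function serves as its own derivative. Its local
      integrability to exponent 1 comes from \<open>g(2)\<close>, so no embedding between different
      exponents enters.\<close>
    case 1
    then have "has_weak_pderiv \<Omega> m n (\<lambda>z. cnj z * f z) (\<lambda>z. cnj z * f z)"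
      using g(2) Lp_loc_cnj_mult by (simp add: has_weak_pderiv_def)
    with cnj_f show ?thesis by blast
  next
    case 2
    then show ?thesis
      using g has_weak_pderiv_x_cnj_mult[OF assms(1)] Lp_loc_lincomb[OF f Lp_loc_cnj_mult[OF g(1)]]
      by blast
  next
    case 3
    then show ?thesis
      using g has_weak_pderiv_y_cnj_mult[OF assms(1)] Lp_loc_lincomb[OF f Lp_loc_cnj_mult[OF g(1)]]
      by blast
  qed
qed

section \<open>Weak Wirtinger derivatives\<close>

lemma has_weak_dz_lincomb:
  assumes "open \<Omega>" "has_weak_dz \<Omega> f f'" "has_weak_dz \<Omega> g g'"
  shows "has_weak_dz \<Omega> (\<lambda>z. a * f z + b * g z) (\<lambda>z. a * f' z + b * g' z)"
proof -
  obtain fx fy gx gy where w: "has_weak_pderiv \<Omega> 1 0 f fx" "has_weak_pderiv \<Omega> 0 1 f fy"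
    "has_weak_pderiv \<Omega> 1 0 g gx" "has_weak_pderiv \<Omega> 0 1 g gy"
    and ae: "AE z in lebesgue_on \<Omega>. f' z = (fx z - \<i> * fy z) / 2"
    "AE z in lebesgue_on \<Omega>. g' z = (gx z - \<i> * gy z) / 2"
    using assms by (auto simp: has_weak_dz_def)
  show ?thesis
    unfolding has_weak_dz_def
  proof (intro exI conjI)
    show "AE z in lebesgue_on \<Omega>. a * f' z + b * g' z =
        ((a * fx z + b * gx z) - \<i> * (a * fy z + b * gy z)) / 2"
      using ae
    proof eventually_elim
      case (elim z)
      show ?case unfolding elim by (simp add: field_simps)
    qed
  qed (intro has_weak_pderiv_lincomb assms(1) w)+
qed

lemma has_weak_dzbar_lincomb:
  assumes "open \<Omega>" "has_weak_dzbar \<Omega> f f'" "has_weak_dzbar \<Omega> g g'"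
  shows "has_weak_dzbar \<Omega> (\<lambda>z. a * f z + b * g z) (\<lambda>z. a * f' z + b * g' z)"
proof -
  obtain fx fy gx gy where w: "has_weak_pderiv \<Omega> 1 0 f fx" "has_weak_pderiv \<Omega> 0 1 f fy"
    "has_weak_pderiv \<Omega> 1 0 g gx" "has_weak_pderiv \<Omega> 0 1 g gy"
    and ae: "AE z in lebesgue_on \<Omega>. f' z = (fx z + \<i> * fy z) / 2"
    "AE z in lebesgue_on \<Omega>. g' z = (gx z + \<i> * gy z) / 2"
    using assms by (auto simp: has_weak_dzbar_def)
  show ?thesis
    unfolding has_weak_dzbar_def
  proof (intro exI conjI)
    show "AE z in lebesgue_on \<Omega>. a * f' z + b * g' z =
        ((a * fx z + b * gx z) + \<i> * (a * fy z + b * gy z)) / 2"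
      using ae
    proof eventually_elim
      case (elim z)
      show ?case unfolding elim by (simp add: field_simps)
    qed
  qed (intro has_weak_pderiv_lincomb assms(1) w)+
qed

lemma has_weak_dz_cnj_mult:
  assumes "open \<Omega>" "has_weak_dz \<Omega> f f'"
  shows "has_weak_dz \<Omega> (\<lambda>z. cnj z * f z) (\<lambda>z. cnj z * f' z)"
proof -
  obtain fx fy where w: "has_weak_pderiv \<Omega> 1 0 f fx" "has_weak_pderiv \<Omega> 0 1 f fy"
    and ae: "AE z in lebesgue_on \<Omega>. f' z = (fx z - \<i> * fy z) / 2"
    using assms by (auto simp: has_weak_dz_def)
  show ?thesis
    unfolding has_weak_dz_def
  proof (intro exI conjI)
    \<comment> \<open>The terms in \<open>f z\<close> cancel because 1 -
      \<open>\<i> * (- \<i>)\<close> = 0: \<open>cnj z\<close> acts as a constant for d/dz.\<close>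
    show "AE z in lebesgue_on \<Omega>. cnj z * f' z =
        ((1 * f z + 1 * (cnj z * fx z)) - \<i> * ((- \<i>) * f z + 1 * (cnj z * fy z))) / 2"
      using ae
    proof eventually_elim
      case (elim z)
      show ?case unfolding elim by (simp add: field_simps)
    qed
  qed (intro has_weak_pderiv_x_cnj_mult has_weak_pderiv_y_cnj_mult assms(1) w)+
qed

lemma has_weak_dzbar_cnj_mult:
  assumes "open \<Omega>" "has_weak_dzbar \<Omega> f f'"
  shows "has_weak_dzbar \<Omega> (\<lambda>z. cnj z * f z) (\<lambda>z. f z + cnj z * f' z)"
proof -
  obtain fx fy where w: "has_weak_pderiv \<Omega> 1 0 f fx" "has_weak_pderiv \<Omega> 0 1 f fy"
    and ae: "AE z in lebesgue_on \<Omega>. f' z = (fx z + \<i> * fy z) / 2"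
    using assms by (auto simp: has_weak_dzbar_def)
  show ?thesis
    unfolding has_weak_dzbar_def
  proof (intro exI conjI)
    \<comment> \<open>Here (1 + \<open>\<i> * (- \<i>)\<close>) / 2 = 1, so exactly one copy of
      \<open>f z\<close> survives.\<close>
    show "AE z in lebesgue_on \<Omega>. f z + cnj z * f' z =
        ((1 * f z + 1 * (cnj z * fx z)) + \<i> * ((- \<i>) * f z + 1 * (cnj z * fy z))) / 2"
      using ae
    proof eventually_elim
      case (elim z)
      show ?case unfolding elim by (simp add: field_simps)
    qed
  qed (intro has_weak_pderiv_x_cnj_mult has_weak_pderiv_y_cnj_mult assms(1) w)+
qed

section \<open>Calculus of the Beltrami operator\<close>

lemma beltrami_op_lincomb:
  assumes "open \<Omega>" "beltrami_op p \<Omega> \<mu> f h" "beltrami_op p \<Omega> \<mu> f' h'"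
  shows "beltrami_op p \<Omega> \<mu> (\<lambda>z. a * f z + b * f' z) (\<lambda>z. a * h z + b * h' z)"
proof -
  obtain g gb g' gb' where w: "has_weak_dz \<Omega> f g" "has_weak_dzbar \<Omega> f gb"
    "has_weak_dz \<Omega> f' g'" "has_weak_dzbar \<Omega> f' gb'"
    and ae: "AE z in lebesgue_on \<Omega>. h z = gb z - \<mu> z * g z"
    "AE z in lebesgue_on \<Omega>. h' z = gb' z - \<mu> z * g' z"
    and sob: "f \<in> sobolev_loc 1 p \<Omega>" "f' \<in> sobolev_loc 1 p \<Omega>"
    using assms by (auto simp: beltrami_op_def)
  show ?thesis
    unfolding beltrami_op_def
  proof (intro exI conjI)
    show "AE z in lebesgue_on \<Omega>. a * h z + b * h' z =
        (a * gb z + b * gb' z) - \<mu> z * (a * g z + b * g' z)"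
      using ae
    proof eventually_elim
      case (elim z)
      show ?case unfolding elim by (simp add: field_simps)
    qed
  qed (intro sobolev_loc_lincomb has_weak_dz_lincomb has_weak_dzbar_lincomb assms(1) w sob)+
qed

text \<open>The extra summand \<open>f z\<close> comes from the dzbar part alone; the dz part, and
  with it \<mu>, merely gets multiplied by \<open>cnj z\<close>.\<close>

lemma beltrami_op_cnj_mult:
  assumes "open \<Omega>" "beltrami_op p \<Omega> \<mu> f h"
  shows "beltrami_op p \<Omega> \<mu> (\<lambda>z. cnj z * f z) (\<lambda>z. f z + cnj z * h z)"
proof -
  obtain g gb where w: "has_weak_dz \<Omega> f g" "has_weak_dzbar \<Omega> f gb"
    and ae: "AE z in lebesgue_on \<Omega>. h z = gb z - \<mu> z * g z"
    and sob: "f \<in> sobolev_loc 1 p \<Omega>"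
    using assms by (auto simp: beltrami_op_def)
  show ?thesis
    unfolding beltrami_op_def
  proof (intro exI conjI)
    show "AE z in lebesgue_on \<Omega>. f z + cnj z * h z = (f z + cnj z * gb z) - \<mu> z * (cnj z * g z)"
      using ae
    proof eventually_elim
      case (elim z)
      show ?case unfolding elim by (simp add: field_simps)
    qed
  qed (intro sobolev_loc_cnj_mult has_weak_dz_cnj_mult has_weak_dzbar_cnj_mult assms(1) w sob)+
qed

lemma beltrami_op_cong:
  assumes "beltrami_op p \<Omega> \<mu> f h" "\<And>z. z \<in> \<Omega> \<Longrightarrow> h z = h' z"
  shows "beltrami_op p \<Omega> \<mu> f h'"
proof -
  have "AE z in lebesgue_on \<Omega>. h' z = gb z - \<mu> z * g z"
    if "AE z in lebesgue_on \<Omega>. h z = gb z - \<mu> z * g z" for gb g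
    using that AE_space by eventually_elim (use assms(2) in auto)
  then show ?thesis using assms(1) unfolding beltrami_op_def by blast
qed

text \<open>Each further factor \<open>cnj z\<close> contributes one more copy of
  \<open>cnj z ^ Suc k * f z\<close>, raising the coefficient by 1. The base case is the product
  rule with image 0.\<close>

lemma beltrami_op_cnj_power_mult:
  assumes "open \<Omega>" "beltrami_op p \<Omega> \<mu> f (\<lambda>_. 0)"
  shows "beltrami_op p \<Omega> \<mu> (\<lambda>z. cnj z ^ Suc k * f z) (\<lambda>z. of_nat (Suc k) * cnj z ^ k * f z)"
proof (induction k)
  case 0
  show ?case using beltrami_op_cnj_mult[OF assms] by simp
next
  case (Suc k)
  show ?case using beltrami_op_cnj_mult[OF assms(1) Suc.IH] by (simp add: algebra_simps)
qed

section \<open>Decomposition of null solutions of the iterated operator\<close>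

lemma beltrami_op_funpow_null:
  assumes "open \<Omega>" "(beltrami_op p \<Omega> \<mu> ^^ n) w (\<lambda>_. 0)"
  shows "\<exists>W. (\<forall>z \<in> \<Omega>. w z = (\<Sum>k<n. cnj z ^ k * W k z)) \<and>
    (\<forall>k<n. beltrami_op p \<Omega> \<mu> (W k) (\<lambda>_. 0))"
  using assms(2)
proof (induction n arbitrary: w)
  \<comment> \<open>The zeroth relational power is equality, so \<open>w\<close> is the zero
    function and the sum is empty.\<close>
  case 0
  then show ?case by simp
next
  case (Suc n)
  \<comment> \<open>The innermost application is split off: \<open>h\<close> is an image of
    \<open>w\<close> and is annihilated by the remaining n applications.\<close>
  obtain h where h: "beltrami_op p \<Omega> \<mu> w h" "(beltrami_op p \<Omega> \<mu> ^^ n) h (\<lambda>_. 0)"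
    using relpowp_Suc_D2[OF Suc.prems] by blast
  from Suc.IH[OF h(2)] obtain V where
    V: "\<And>z. z \<in> \<Omega> \<Longrightarrow> h z = (\<Sum>k<n. cnj z ^ k * V k z)"
      "\<And>k. k < n \<Longrightarrow> beltrami_op p \<Omega> \<mu> (V k) (\<lambda>_. 0)" by blast
  \<comment> \<open>The antiderivatives are subtracted one at a time; \<open>m \<le> n\<close>
    ensures that each \<open>V k\<close> used is a null solution.\<close>
  have "beltrami_op p \<Omega> \<mu> (\<lambda>z. w z - (\<Sum>k<m. cnj z ^ Suc k * V k z / of_nat (Suc k)))
      (\<lambda>z. h z - (\<Sum>k<m. cnj z ^ k * V k z))" if "m \<le> n" for m
    using that
  proof (induction m)
    case 0
    with h(1) show ?case by simp
  next
    case (Suc m)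
    \<comment> \<open>The coefficient \<open>- 1 / of_nat (Suc m)\<close> cancels the factor
      produced by the power rule.\<close>
    have "beltrami_op p \<Omega> \<mu>
        (\<lambda>z. 1 * (w z - (\<Sum>k<m. cnj z ^ Suc k * V k z / of_nat (Suc k))) +
          (- 1 / of_nat (Suc m)) * (cnj z ^ Suc m * V m z))
        (\<lambda>z. 1 * (h z - (\<Sum>k<m. cnj z ^ k * V k z)) +
          (- 1 / of_nat (Suc m)) * (of_nat (Suc m) * cnj z ^ m * V m z))"
      using Suc by (intro beltrami_op_lincomb beltrami_op_cnj_power_mult V(2) assms(1)) auto
    moreover have "(- 1 / of_nat (Suc m)) * (of_nat (Suc m) * x * y) = - (x * y)" for x y :: complex
      using of_nat_neq_0[of m, where ?'a = complex] by (simp del: of_nat_Suc)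
    ultimately show ?case by (simp add: diff_diff_eq del: of_nat_Suc)
  qed
  \<comment> \<open>For m = n the image vanishes, but only at points of \<Omega>, where the
    expansion of \<open>h\<close> holds; the congruence rule replaces it by the constant 0.\<close>
  from beltrami_op_cong[OF this[OF order_refl], of "\<lambda>_. 0"] V(1)
  have W0: "beltrami_op p \<Omega> \<mu> (\<lambda>z. w z - (\<Sum>k<n. cnj z ^ Suc k * V k z / of_nat (Suc k))) (\<lambda>_. 0)"
    by simp
  \<comment> \<open>The remainder becomes the coefficient of power 0, and
    \<open>V k / (k + 1)\<close> that of power k + 1. The summand \<open>0 * V k z\<close> gives the
    shape of \<open>beltrami_op_lincomb\<close>.\<close>
  define W where "W k = (case k of
      0 \<Rightarrow> (\<lambda>z. w z - (\<Sum>k<n. cnj z ^ Suc k * V k z / of_nat (Suc k)))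
    | Suc k \<Rightarrow> (\<lambda>z. 1 / of_nat (Suc k) * V k z + 0 * V k z))" for k
  have "beltrami_op p \<Omega> \<mu> (W k) (\<lambda>_. 0)" if "k < Suc n" for k
  proof (cases k)
    case 0
    with W0 show ?thesis by (simp add: W_def)
  next
    case (Suc j)
    with that have "beltrami_op p \<Omega> \<mu> (V j) (\<lambda>_. 0)" by (intro V(2)) simp
    from beltrami_op_lincomb[OF assms(1) this this, of "1 / of_nat (Suc j)" 0]
    show ?thesis using Suc by (simp add: W_def)
  qed
  moreover have "w z = (\<Sum>k<Suc n. cnj z ^ k * W k z)" for z
    \<comment> \<open>Splitting off the term of index 0 leaves exactly the sum that was subtracted
      from \<open>w\<close>.\<close>
    unfolding sum.lessThan_Suc_shift by (simp add: W_def del: of_nat_Suc)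
  ultimately show ?case by blast
qed

theorem theorem3p8:
  fixes n :: nat and \<mu> w :: "complex \<Rightarrow> complex" and c :: real and p :: ennreal
  assumes "n > 0"
    and "\<mu> \<in> sobolev (n - 1) \<infinity> (ball 0 1)"
    and "c > 0" and "c < 1"
    and "sobolev_inf_norm (n - 1) (ball 0 1) \<mu> \<le> ennreal c"
    and "p \<ge> 1"
    and "(beltrami_op p (ball 0 1) \<mu> ^^ n) w (\<lambda>_. 0)"
  shows "\<exists>W :: nat \<Rightarrow> complex \<Rightarrow> complex.
    (\<forall>z \<in> ball 0 1. w z = (\<Sum>k = 0..n - 1. cnj z ^ k * W k z)) \<and>
    (\<forall>k \<le> n - 1. W k \<in> sobolev_loc 1 p (ball 0 1) \<and>
       (\<exists>g. has_weak_dz (ball 0 1) (W k) g \<and>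
            has_weak_dzbar (ball 0 1) (W k) (\<lambda>z. \<mu> z * g z)))"
proof -
  let ?D = "ball 0 1 :: complex set"
  have null: "f \<in> sobolev_loc 1 p ?D \<and>
      (\<exists>g. has_weak_dz ?D f g \<and> has_weak_dzbar ?D f (\<lambda>z. \<mu> z * g z))"
    if B: "beltrami_op p ?D \<mu> f (\<lambda>_. 0)" for f
  proof -
    obtain g gb where g: "has_weak_dz ?D f g" "has_weak_dzbar ?D f gb"
      and ae: "AE z in lebesgue_on ?D. 0 = gb z - \<mu> z * g z"
      and sob: "f \<in> sobolev_loc 1 p ?D"
      using B by (auto simp: beltrami_op_def)
    obtain fx fy where f: "has_weak_pderiv ?D 1 0 f fx" "has_weak_pderiv ?D 0 1 f fy"
      and ae': "AE z in lebesgue_on ?D. gb z = (fx z + \<i> * fy z) / 2"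
      using g(2) by (auto simp: has_weak_dzbar_def)
    \<comment> \<open>Wirtinger derivatives are fixed only up to null sets, so \<open>gb\<close> may
      be exchanged for the almost everywhere equal \<open>\<mu> z * g z\<close>.\<close>
    have "AE z in lebesgue_on ?D. \<mu> z * g z = (fx z + \<i> * fy z) / 2"
      using ae ae' by eventually_elim simp
    with f have "has_weak_dzbar ?D f (\<lambda>z. \<mu> z * g z)" unfolding has_weak_dzbar_def by blast
    with g(1) sob show ?thesis by blast
  qed
  obtain W where W: "\<And>z. z \<in> ?D \<Longrightarrow> w z = (\<Sum>k<n. cnj z ^ k * W k z)"
    "\<And>k. k < n \<Longrightarrow> beltrami_op p ?D \<mu> (W k) (\<lambda>_. 0)"
    using beltrami_op_funpow_null[OF open_ball assms(7)] by blast
  \<comment> \<open>Subtraction on naturals truncates: for n = 0 the left side would be {0} and the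
    right side empty.\<close>
  have "{0..n - 1} = {..<n}" using \<open>n > 0\<close> by auto
  then show ?thesis using W null \<open>n > 0\<close> by (intro exI[of _ W]) auto
qed

end
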